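(* Let $X$ be a finite non-empty set and let $f:\mathcal{P}(X)\to\mathbb{R}$ be a nonnegative, monotone, submodular set function on $X$. For $A,B\subseteq X$ define \[J^\Delta_{\delta,f}(A,B)=\frac{f(A\triangle B)-f(\emptyset)}{f(A\cup B)}\] if $f(A\cup B)\neq 0$, and $J^\Delta_{\delta,f}(A,B)=0$ if $f(A\cup B)=0$, where $A\triangle B$ denotes the symmetric difference. Then for all sets $A,B,C\subseteq X$, \[J^\Delta_{\delta,f}(A,B)\le J^\Delta_{\delta,f}(A,C)+J^\Delta_{\delta,f}(C,B).\]
   Context: A set function $f:\mathcal{P}(X)\to\mathbb{R}$ is submodular if $f(A\cup B)+f(A\cap B)\le f(A)+f(B)$ for all $A,B\subseteq X$; monotone if $f(A)\le f(B)$ whenever $A\subseteq B\subseteq X$; nonnegative if $f(A)\ge 0$ for all $A\subseteq X$. *)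

theory Defs
  imports Complex_Main
begin

(* Set functions on X are total functions of type 'a set => real, of which only the values
   on Pow X are constrained; monotonicity is the library notion mono_on (Pow X) f. *)

definition submodular_on :: "'a set \<Rightarrow> ('a set \<Rightarrow> real) \<Rightarrow> bool" where
  "submodular_on X f \<longleftrightarrow>
     (\<forall>A B. A \<subseteq> X \<longrightarrow> B \<subseteq> X \<longrightarrow> f (A \<union> B) + f (A \<inter> B) \<le> f A + f B)"

definition nonnegative_on :: "'a set \<Rightarrow> ('a set \<Rightarrow> real) \<Rightarrow> bool" where
  "nonnegative_on X f \<longleftrightarrow> (\<forall>A. A \<subseteq> X \<longrightarrow> f A \<ge> 0)"

definition jaccard_sym_diff :: "('a set \<Rightarrow> real) \<Rightarrow> 'a set \<Rightarrow> 'a set \<Rightarrow> real" where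
  "jaccard_sym_diff f A B =
     (if f (A \<union> B) \<noteq> 0 then (f (sym_diff A B) - f {}) / f (A \<union> B) else 0)"

end

theory Submission
  imports Defs
begin

text \<open>
  Put \<open>g = f - f {}\<close>, \<open>U = A \<union> B \<union> C\<close>, \<open>W = C - (A \<union> B)\<close> and \<open>t = f U - f (A \<union> B)\<close>.
  Since \<open>g (A \<triangle> B) \<le> f (A \<union> B)\<close>, adding \<open>t\<close> to numerator and denominator does not decrease
  the left-hand side, so it is at most \<open>(g (A \<triangle> B) + t) / f U\<close>; by monotonicity the right-hand
  side is at least \<open>(g (A \<triangle> C) + g (C \<triangle> B)) / f U\<close>.  The numerators compare because the union of
  \<open>A \<triangle> C\<close> and \<open>C \<triangle> B\<close> contains \<open>A \<triangle> B\<close>, their intersection contains \<open>W\<close>, and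
  submodularity gives \<open>t \<le> g W\<close>.
\<close>

text \<open>Division by zero yields 0 in HOL, which is exactly the value prescribed in the
  degenerate case.\<close>

lemma jaccard_sym_diff_eq:
  "jaccard_sym_diff f A B = (f (sym_diff A B) - f {}) / f (A \<union> B)"
  by (simp add: jaccard_sym_diff_def)

lemma divide_le_add_divide_add:
  fixes a b t :: real
  assumes "a \<le> b" "0 < b" "0 \<le> t"
  shows "a / b \<le> (a + t) / (b + t)"
proof -
  have "a * t \<le> b * t"
    using assms by (intro mult_right_mono)
  then show ?thesis
    using assms by (simp add: divide_simps algebra_simps)
qed

context
  fixes X :: "'a set" and f :: "'a set \<Rightarrow> real"
  assumes nonneg: "nonnegative_on X f"
    and mono: "mono_on (Pow X) f"
    and submod: "submodular_on X f"
begin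

lemma f_nonneg: "A \<subseteq> X \<Longrightarrow> 0 \<le> f A"
  using nonneg by (simp add: nonnegative_on_def)

lemma f_mono: "A \<subseteq> B \<Longrightarrow> B \<subseteq> X \<Longrightarrow> f A \<le> f B"
  using mono by (auto intro: mono_onD)

lemma f_submodular: "A \<subseteq> X \<Longrightarrow> B \<subseteq> X \<Longrightarrow> f (A \<union> B) + f (A \<inter> B) \<le> f A + f B"
  using submod by (simp add: submodular_on_def)

lemma jaccard_sym_diff_ge:
  assumes "A \<union> B \<subseteq> U" "U \<subseteq> X"
  shows "(f (sym_diff A B) - f {}) / f U \<le> jaccard_sym_diff f A B"
proof -
  have sub: "A \<union> B \<subseteq> X" "sym_diff A B \<subseteq> X"
    using assms by auto
  have num: "f {} \<le> f (sym_diff A B)" "f (sym_diff A B) \<le> f (A \<union> B)"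
    using sub by (auto intro!: f_mono)
  have e: "0 \<le> f {}" and den: "f (A \<union> B) \<le> f U" "0 \<le> f (A \<union> B)"
    using assms sub by (auto intro!: f_mono f_nonneg)
  show ?thesis
  proof (cases "f (A \<union> B) = 0")
    case True
    \<comment> \<open>The right-hand side is now 0, so the left numerator has to vanish: it does,
      since 0 \<le> \<open>f {}\<close> \<le> \<open>f (sym_diff A B)\<close> \<le>
      \<open>f (A \<union> B)\<close> = 0.\<close>
    then have "f (sym_diff A B) = f {}"
      using num e by linarith
    then show ?thesis
      by (simp add: jaccard_sym_diff_eq)
  next
    case False
    then show ?thesis
      using num den by (auto simp: jaccard_sym_diff_eq intro!: divide_left_mono)
  qed
qed

lemma sym_diff_marginal_le:
  assumes "A \<subseteq> X" "B \<subseteq> X" "C \<subseteq> X"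
  shows "f (sym_diff A B) + f (A \<union> B \<union> C) + f {}
    \<le> f (sym_diff A C) + f (sym_diff C B) + f (A \<union> B)"
proof -
  let ?W = "C - (A \<union> B)"
  have "f (sym_diff A C \<union> sym_diff C B) + f (sym_diff A C \<inter> sym_diff C B)
      \<le> f (sym_diff A C) + f (sym_diff C B)"
    using assms by (intro f_submodular) auto
  \<comment> \<open>Where \<open>A\<close> and \<open>B\<close> disagree, \<open>C\<close> disagrees
    with one of them; on \<open>?W\<close> it disagrees with both.\<close>
  moreover have "f (sym_diff A B) \<le> f (sym_diff A C \<union> sym_diff C B)"
    using assms by (intro f_mono) auto
  moreover have "f ?W \<le> f (sym_diff A C \<inter> sym_diff C B)"
    using assms by (intro f_mono) auto
  moreover have "f (A \<union> B \<union> C) + f {} \<le> f (A \<union> B) + f ?W"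
  proof -
    have "(A \<union> B) \<union> ?W = A \<union> B \<union> C" "(A \<union> B) \<inter> ?W = {}"
      by auto
    then show ?thesis
      using f_submodular[of "A \<union> B" ?W] assms by auto
  qed
  ultimately show ?thesis
    by linarith
qed

lemma jaccard_sym_diff_triangle:
  assumes "A \<subseteq> X" "B \<subseteq> X" "C \<subseteq> X"
  shows "jaccard_sym_diff f A B \<le> jaccard_sym_diff f A C + jaccard_sym_diff f C B"
proof -
  let ?U = "A \<union> B \<union> C"
  let ?g = "\<lambda>S. f S - f {}"
  have U: "0 \<le> f ?U"
    using assms by (auto intro!: f_nonneg)
  have rhs: "(?g (sym_diff A C) + ?g (sym_diff C B)) / f ?U
      \<le> jaccard_sym_diff f A C + jaccard_sym_diff f C B"
    unfolding add_divide_distrib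
    using assms by (intro add_mono jaccard_sym_diff_ge) auto
  show ?thesis
  proof (cases "f (A \<union> B) = 0")
    case True
    \<comment> \<open>The left-hand side is 0 by convention, so a nonnegative lower bound for the
      right suffices; \<open>f ?U\<close> may itself be 0.\<close>
    have "f {} \<le> f (sym_diff A C)" "f {} \<le> f (sym_diff C B)"
      using assms by (auto intro!: f_mono)
    then have "0 \<le> (?g (sym_diff A C) + ?g (sym_diff C B)) / f ?U"
      using U by simp
    then show ?thesis
      using rhs True by (simp add: jaccard_sym_diff_eq[of f A B])
  next
    case False
    define t where "t = f ?U - f (A \<union> B)"
    have pos: "0 < f (A \<union> B)"
      using False f_nonneg[of "A \<union> B"] assms by auto
    have t: "0 \<le> t"
      unfolding t_def using assms f_mono[of "A \<union> B" ?U] by auto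
    have "f (sym_diff A B) \<le> f (A \<union> B)"
      using assms by (intro f_mono) auto
    \<comment> \<open>Subtracting \<open>f {}\<close> preserves the bound because
      \<open>f {}\<close> is nonnegative; the fraction is thus at most 1.\<close>
    then have "?g (sym_diff A B) \<le> f (A \<union> B)"
      using f_nonneg[of "{}"] by simp
    then have "jaccard_sym_diff f A B \<le> (?g (sym_diff A B) + t) / (f (A \<union> B) + t)"
      unfolding jaccard_sym_diff_eq using pos t by (rule divide_le_add_divide_add)
    also have "\<dots> = (?g (sym_diff A B) + t) / f ?U"
      by (simp add: t_def)
    also have "\<dots> \<le> (?g (sym_diff A C) + ?g (sym_diff C B)) / f ?U"
      using sym_diff_marginal_le[OF assms] U by (intro divide_right_mono) (auto simp: t_def)
    finally show ?thesis
      using rhs by linarith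
  qed
qed

end

theorem theorem2:
  fixes X :: "'a set" and f :: "'a set \<Rightarrow> real"
  assumes "finite X" and "X \<noteq> {}"
    and "nonnegative_on X f"
    and "mono_on (Pow X) f"
    and "submodular_on X f"
  shows "\<forall>A B C. A \<subseteq> X \<longrightarrow> B \<subseteq> X \<longrightarrow> C \<subseteq> X \<longrightarrow>
           jaccard_sym_diff f A B \<le> jaccard_sym_diff f A C + jaccard_sym_diff f C B"
  using jaccard_sym_diff_triangle[OF assms(3-5)] by blast

end
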